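(* Let $\tau_1=\tau_{r_1(m_1),r_2(m_2)}$ and $\tau_2=\tau_{r_3(m_3),r_4(m_4)}$ be class transpositions and let $\{S_i\}_{i\in I}$ be the set of connected components of the graph $\Gamma(\tau_1,\tau_2)$. There exists an injection $\psi$ of the set of connected components $\{S_i\}_{i\in I}$ into permutations belonging to the product $\tau_1\cdot\tau_2$ such that $\mathrm{Supp}(\psi(S_i))\cap \mathrm{Supp}(\psi(S_j))=\emptyset$ if $i\neq j$. In this case, $$\prod_{i\in I}\psi(S_i)=\tau_1\cdot\tau_2 .$$
   Context: For integers $0\le r<m$ write $r(m)=r+m\mathbb{Z}$. If $r_1(m_1)\cap r_2(m_2)=\emptyset$, the class transposition $\tau_{r_1(m_1),r_2(m_2)}$ is the permutation of $\mathbb{Z}$ interchanging $r_1+km_1$ and $r_2+km_2$ for every $k\in\mathbb{Z}$ and fixing every other integer. Products are composed from left to right: $\tau_1\cdot\tau_2$ means first $\tau_1$, then $\tau_2$. The graph $\Gamma(\tau_1,\tau_2)$ is the undirected graph with vertex set $V=V_1\sqcup V_2$, where $V_1=\{a_k,b_k : k\in\mathbb{Z}\}$ and $V_2=\{c_l,d_l : l\in\mathbb{Z}\}$ are disjoint sets of distinct symbols. Define $\mu:V\to\mathbb{Z}$ by $\mu(a_k)=r_1+m_1k$, $\mu(b_k)=r_2+m_2k$, $\mu(c_l)=r_3+m_3l$, $\mu(d_l)=r_4+m_4l$. A pair $\{u,v\}$ is an edge if and only if one of the following holds: $\mu(u)=\mu(v)$ with one of $u,v$ in $V_1$ and the other in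 $V_2$; or $u,v\in V_1$ and $\tau_1(\mu(u))=\mu(v)$; or $u,v\in V_2$ and $\tau_2(\mu(u))=\mu(v)$. A permutation belonging to the product $\tau_1\cdot\tau_2$ is a permutation of $\mathbb{Z}$ that is a cycle, or a product of two independent cycles (finite or infinite), occurring in the decomposition of $\tau_1\cdot\tau_2$ into independent cycles. For a permutation $\pi$ of $\mathbb{Z}$, $\mathrm{Supp}(\pi)$ is the set of integers moved by $\pi$.
   Formalization: The literal claim fails if many components are 4-cycles (e.g. τ1=τ2, product the identity); here 1-cycles on points moved by τ1 or τ2 count as cycles, each permutation belonging to the product is paired with the point set of its cycles, and ψ is injective into these pairs. *)

theory Defs
  imports Main "HOL-Combinatorics.Orbits"
begin

definition residue_class :: "int \<Rightarrow> int \<Rightarrow> int set" where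
  "residue_class r m = {r + k * m | k. True}"

definition class_transposition :: "int \<Rightarrow> int \<Rightarrow> int \<Rightarrow> int \<Rightarrow> int \<Rightarrow> int" where
  "class_transposition r1 m1 r2 m2 n =
     (if n \<in> residue_class r1 m1 then r2 + (n - r1) div m1 * m2
      else if n \<in> residue_class r2 m2 then r1 + (n - r2) div m2 * m1
      else n)"

lemma class_transposition_swap:
  assumes "0 < m1" "0 < m2" "residue_class r1 m1 \<inter> residue_class r2 m2 = {}"
  shows "class_transposition r1 m1 r2 m2 (r1 + k * m1) = r2 + k * m2"
    and "class_transposition r1 m1 r2 m2 (r2 + k * m2) = r1 + k * m1"
    and "n \<notin> residue_class r1 m1 \<union> residue_class r2 m2 \<Longrightarrow>
           class_transposition r1 m1 r2 m2 n = n"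
proof -
  have 1: "r1 + k * m1 \<in> residue_class r1 m1" and 2: "r2 + k * m2 \<in> residue_class r2 m2"
    by (auto simp: residue_class_def)
  with assms(3) have 3: "r2 + k * m2 \<notin> residue_class r1 m1"
    by blast
  show "class_transposition r1 m1 r2 m2 (r1 + k * m1) = r2 + k * m2"
    using 1 assms(1) by (simp add: class_transposition_def)
  show "class_transposition r1 m1 r2 m2 (r2 + k * m2) = r1 + k * m1"
    using 2 3 assms(2) by (simp add: class_transposition_def)
  show "n \<notin> residue_class r1 m1 \<union> residue_class r2 m2 \<Longrightarrow>
          class_transposition r1 m1 r2 m2 n = n"
    by (simp add: class_transposition_def)
qed

definition Supp :: "('a \<Rightarrow> 'a) \<Rightarrow> 'a set" where
  "Supp \<pi> = {x. \<pi> x \<noteq> x}"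

datatype vertex = A int | B int | C int | D int

definition V1 :: "vertex set" where
  "V1 = range A \<union> range B"

definition V2 :: "vertex set" where
  "V2 = range C \<union> range D"

fun vertex_value ::
  "int \<Rightarrow> int \<Rightarrow> int \<Rightarrow> int \<Rightarrow> int \<Rightarrow> int \<Rightarrow> int \<Rightarrow> int \<Rightarrow> vertex \<Rightarrow> int" where
  "vertex_value r1 m1 r2 m2 r3 m3 r4 m4 (A k) = r1 + m1 * k"
| "vertex_value r1 m1 r2 m2 r3 m3 r4 m4 (B k) = r2 + m2 * k"
| "vertex_value r1 m1 r2 m2 r3 m3 r4 m4 (C l) = r3 + m3 * l"
| "vertex_value r1 m1 r2 m2 r3 m3 r4 m4 (D l) = r4 + m4 * l"

definition Gamma_edges ::
  "(vertex \<Rightarrow> int) \<Rightarrow> (int \<Rightarrow> int) \<Rightarrow> (int \<Rightarrow> int) \<Rightarrow> vertex set set" where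
  "Gamma_edges \<mu> \<tau>1 \<tau>2 =
     {{u, v} | u v.
        (\<mu> u = \<mu> v \<and> (u \<in> V1 \<and> v \<in> V2 \<or> u \<in> V2 \<and> v \<in> V1)) \<or>
        (u \<in> V1 \<and> v \<in> V1 \<and> \<tau>1 (\<mu> u) = \<mu> v) \<or>
        (u \<in> V2 \<and> v \<in> V2 \<and> \<tau>2 (\<mu> u) = \<mu> v)}"

(* The connected components, as vertex sets, of the undirected graph with vertex set UNIV
   and edge set E. *)
definition connected_components :: "'v set set \<Rightarrow> 'v set set" where
  "connected_components E = UNIV // {(u, v). {u, v} \<in> E}\<^sup>*"

(* The orbit of x under all integer powers of a permutation; Orbits.orbit only uses
   positive powers, hence yields half of an infinite cycle. *)
definition full_orbit :: "('a \<Rightarrow> 'a) \<Rightarrow> 'a \<Rightarrow> 'a set" where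
  "full_orbit \<sigma> x = {y. \<exists>n. (\<sigma> ^^ n) x = y \<or> (\<sigma> ^^ n) y = x}"

(* The independent cycles of \<sigma>, where \<sigma> is decomposed as a permutation of the invariant
   set X. Each cycle is a permutation of the whole type paired with the orbit it permutes.
   The orbit is recorded because all cycles of length 1 are the identity as functions:
   the cycles (x) and (y) for x \<noteq> y are distinct members of the decomposition. *)
definition independent_cycles :: "'a set \<Rightarrow> ('a \<Rightarrow> 'a) \<Rightarrow> ('a set \<times> ('a \<Rightarrow> 'a)) set" where
  "independent_cycles X \<sigma> =
     {(full_orbit \<sigma> x, perm_restrict \<sigma> (full_orbit \<sigma> x)) | x. x \<in> X}"

(* The permutations belonging to the product "first \<tau>1, then \<tau>2", each paired with the set of
   points occurring in its one or two cycles. The product is decomposed as a permutation of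
   Supp \<tau>1 \<union> Supp \<tau>2, so a cycle (x) of length 1 occurs only if x is moved by \<tau>1 and \<tau>2 but
   fixed by their product. If there is no such x, all cycles have length at least 2 and the
   recorded set is just the support. Recording it is necessary for an injection from the
   components: a component that is a 4-cycle a-b-c-d corresponds to two cycles of length 1,
   whose product is the identity, and there can be infinitely many such components (e.g. if
   \<tau>1 = \<tau>2). *)
definition belonging_perms ::
  "(int \<Rightarrow> int) \<Rightarrow> (int \<Rightarrow> int) \<Rightarrow> (int set \<times> (int \<Rightarrow> int)) set" where
  "belonging_perms \<tau>1 \<tau>2 =
     (let Z = independent_cycles (Supp \<tau>1 \<union> Supp \<tau>2) (\<tau>2 \<circ> \<tau>1) in
        Z \<union> {(O1 \<union> O2, \<pi>2 \<circ> \<pi>1) | O1 \<pi>1 O2 \<pi>2.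
               (O1, \<pi>1) \<in> Z \<and> (O2, \<pi>2) \<in> Z \<and> O1 \<inter> O2 = {}})"

(* The product of a possibly infinite family of permutations with pairwise disjoint supports:
   every point is moved by the unique factor that moves it, if there is one. *)
definition disjoint_prod :: "'i set \<Rightarrow> ('i \<Rightarrow> 'a \<Rightarrow> 'a) \<Rightarrow> 'a \<Rightarrow> 'a" where
  "disjoint_prod I f x =
     (if \<exists>i\<in>I. x \<in> Supp (f i) then f (THE i. i \<in> I \<and> x \<in> Supp (f i)) x else x)"

end

theory Submission
  imports Defs
begin

text \<open>
  Both transpositions are involutions, so they generate a dihedral group acting on the integers.
  Every connected component of the graph is the full preimage under \<open>\<mu>\<close> of one orbit of this
  group: an edge either keeps the value of \<open>\<mu>\<close> or applies one of the generators, and conversely each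
  moved point has exactly one vertex on the side of the transposition that moves it, where an edge
  realises the application of that transposition; a generator that fixes the point has no edge, but
  needs none (\<open>image_component\<close>).

  Write \<open>\<sigma>\<close> for the product. Since \<open>\<tau>1\<close> conjugates \<open>\<sigma>\<close> to its inverse, it carries the cycle of \<open>x\<close>
  onto the cycle of \<open>\<tau>1 x\<close>, and the dihedral orbit of \<open>x\<close> is the union of these two cycles, which
  coincide or are disjoint. Hence the restriction of \<open>\<sigma>\<close> to a dihedral orbit is one cycle or a
  product of two independent cycles (\<open>restriction_to_dihedral_orbit_belongs\<close>). The map \<open>\<psi>\<close> sends a
  component to the restriction of \<open>\<sigma>\<close> to its image under \<open>\<mu>\<close>. Distinct components have disjoint
  images (\<open>components_eq_if_images_meet\<close>), and the images cover every point moved by \<open>\<sigma>\<close>, so the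
  restrictions multiply to \<open>\<sigma>\<close>.
\<close>

section \<open>Full orbits of an injective map\<close>

lemma full_orbit_refl: "x \<in> full_orbit \<sigma> x"
proof -
  have "(\<sigma> ^^ 0) x = x" by simp
  then show ?thesis unfolding full_orbit_def by blast
qed

lemma full_orbit_sym: "y \<in> full_orbit \<sigma> x \<Longrightarrow> x \<in> full_orbit \<sigma> y"
  unfolding full_orbit_def by blast

lemma full_orbit_subset:
  assumes "x \<in> Y" and closed: "\<And>y. \<sigma> y \<in> Y \<longleftrightarrow> y \<in> Y"
  shows "full_orbit \<sigma> x \<subseteq> Y"
proof
  fix y assume "y \<in> full_orbit \<sigma> x"
  moreover have "(\<sigma> ^^ n) z \<in> Y \<longleftrightarrow> z \<in> Y" for n z
    by (induction n) (simp_all add: closed)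
  ultimately show "y \<in> Y"
    using \<open>x \<in> Y\<close> unfolding full_orbit_def by auto
qed

lemma image_in_full_orbit_iff:
  assumes "inj \<sigma>"
  shows "\<sigma> y \<in> full_orbit \<sigma> x \<longleftrightarrow> y \<in> full_orbit \<sigma> x"
proof
  assume "y \<in> full_orbit \<sigma> x"
  then obtain n where "(\<sigma> ^^ n) x = y \<or> (\<sigma> ^^ n) y = x"
    unfolding full_orbit_def by auto
  then have "(\<sigma> ^^ Suc n) x = \<sigma> y \<or> (\<sigma> ^^ 1) x = \<sigma> y \<or> (\<sigma> ^^ (n - 1)) (\<sigma> y) = x"
    by (cases n) (auto simp: funpow_swap1)
  then show "\<sigma> y \<in> full_orbit \<sigma> x"
    unfolding full_orbit_def by blast
next
  assume "\<sigma> y \<in> full_orbit \<sigma> x"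
  then obtain n where "(\<sigma> ^^ n) x = \<sigma> y \<or> (\<sigma> ^^ n) (\<sigma> y) = x"
    unfolding full_orbit_def by auto
  then have "(\<sigma> ^^ (n - 1)) x = y \<or> (\<sigma> ^^ 1) y = x \<or> (\<sigma> ^^ Suc n) y = x"
    using injD[OF assms] by (cases n) (auto simp: funpow_swap1)
  then show "y \<in> full_orbit \<sigma> x"
    unfolding full_orbit_def by blast
qed

lemma full_orbit_mono:
  assumes "inj \<sigma>" "y \<in> full_orbit \<sigma> x"
  shows "full_orbit \<sigma> y \<subseteq> full_orbit \<sigma> x"
  using assms by (intro full_orbit_subset) (simp_all add: image_in_full_orbit_iff)

lemma full_orbits_eq_or_disjoint:
  assumes "inj \<sigma>"
  shows "full_orbit \<sigma> x = full_orbit \<sigma> y \<or> full_orbit \<sigma> x \<inter> full_orbit \<sigma> y = {}"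
proof (rule disjCI)
  assume "full_orbit \<sigma> x \<inter> full_orbit \<sigma> y \<noteq> {}"
  then obtain z where z: "z \<in> full_orbit \<sigma> x" "z \<in> full_orbit \<sigma> y" by blast
  have "full_orbit \<sigma> a = full_orbit \<sigma> z" if "z \<in> full_orbit \<sigma> a" for a
    using full_orbit_mono[OF assms that] full_orbit_mono[OF assms full_orbit_sym[OF that]]
    by (rule equalityI[rotated])
  with z show "full_orbit \<sigma> x = full_orbit \<sigma> y" by metis
qed

section \<open>Orbits of a pair of involutions\<close>

locale involution_pair =
  fixes \<tau>1 \<tau>2 :: "'a \<Rightarrow> 'a"
  assumes \<tau>1_\<tau>1 [simp]: "\<tau>1 (\<tau>1 x) = x"
    and \<tau>2_\<tau>2 [simp]: "\<tau>2 (\<tau>2 x) = x"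
begin

abbreviation \<sigma> :: "'a \<Rightarrow> 'a" where
  "\<sigma> \<equiv> \<tau>2 \<circ> \<tau>1"

text \<open>
  A dihedral group consists of the powers of \<open>\<sigma>\<close> and the elements that apply \<open>\<tau>1\<close> before such a
  power, so the orbit of the group needs no more than two orbits of \<open>\<sigma>\<close>.
\<close>

definition dihedral_orbit :: "'a \<Rightarrow> 'a set" where
  "dihedral_orbit x = full_orbit \<sigma> x \<union> full_orbit \<sigma> (\<tau>1 x)"

lemma inj_\<sigma>: "inj \<sigma>"
  by (rule inj_on_inverseI[of _ "\<tau>1 \<circ> \<tau>2"]) simp

lemma dihedral_orbit_refl: "x \<in> dihedral_orbit x"
  by (simp add: dihedral_orbit_def full_orbit_refl)

text \<open>Conjugation by \<open>\<tau>1\<close> inverts \<open>\<sigma>\<close>, and a full orbit is the same for \<open>\<sigma>\<close> and its inverse.\<close>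

lemma \<tau>1_maps_full_orbit:
  assumes "y \<in> full_orbit \<sigma> x"
  shows "\<tau>1 y \<in> full_orbit \<sigma> (\<tau>1 x)"
proof -
  have "\<tau>1 (\<sigma> z) \<in> full_orbit \<sigma> (\<tau>1 x) \<longleftrightarrow> \<tau>1 z \<in> full_orbit \<sigma> (\<tau>1 x)" for z
    using image_in_full_orbit_iff[OF inj_\<sigma>, of "\<tau>1 (\<sigma> z)" "\<tau>1 x"] by simp
  then have "full_orbit \<sigma> x \<subseteq> {z. \<tau>1 z \<in> full_orbit \<sigma> (\<tau>1 x)}"
    by (intro full_orbit_subset) (simp_all add: full_orbit_refl)
  with assms show ?thesis by blast
qed

lemma \<tau>1_in_dihedral_orbit:
  "y \<in> dihedral_orbit x \<Longrightarrow> \<tau>1 y \<in> dihedral_orbit x"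
  using \<tau>1_maps_full_orbit[of y x] \<tau>1_maps_full_orbit[of y "\<tau>1 x"]
  by (auto simp: dihedral_orbit_def)

lemma \<tau>2_in_dihedral_orbit:
  assumes "y \<in> dihedral_orbit x"
  shows "\<tau>2 y \<in> dihedral_orbit x"
proof -
  have "\<sigma> (\<tau>1 y) \<in> dihedral_orbit x"
    using \<tau>1_in_dihedral_orbit[OF assms] image_in_full_orbit_iff[OF inj_\<sigma>]
    unfolding dihedral_orbit_def by blast
  then show ?thesis by simp
qed

lemma dihedral_orbit_subset:
  assumes "x \<in> Y" "\<And>y. y \<in> Y \<Longrightarrow> \<tau>1 y \<in> Y" "\<And>y. y \<in> Y \<Longrightarrow> \<tau>2 y \<in> Y"
  shows "dihedral_orbit x \<subseteq> Y"
proof -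
  have "\<sigma> y \<in> Y \<longleftrightarrow> y \<in> Y" for y
    using assms(2,3) by (metis comp_apply \<tau>1_\<tau>1 \<tau>2_\<tau>2)
  then show ?thesis
    unfolding dihedral_orbit_def
    using full_orbit_subset[of x Y \<sigma>] full_orbit_subset[of "\<tau>1 x" Y \<sigma>] assms(1,2) by blast
qed

lemma \<tau>1_in_Supp_union:
  "x \<in> Supp \<tau>1 \<union> Supp \<tau>2 \<Longrightarrow> \<tau>1 x \<in> Supp \<tau>1 \<union> Supp \<tau>2"
  by (auto simp: Supp_def)

end

text \<open>
  The two full orbits that make up a dihedral orbit are equal, giving a single cycle, or disjoint,
  giving two independent ones.
\<close>

lemma restriction_to_dihedral_orbit_belongs:
  fixes \<tau>1 \<tau>2 :: "int \<Rightarrow> int"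
  assumes "involution_pair \<tau>1 \<tau>2" and x: "x \<in> Supp \<tau>1 \<union> Supp \<tau>2"
  defines "Q \<equiv> involution_pair.dihedral_orbit \<tau>1 \<tau>2 x"
  shows "(Q, perm_restrict (\<tau>2 \<circ> \<tau>1) Q) \<in> belonging_perms \<tau>1 \<tau>2"
proof -
  interpret involution_pair \<tau>1 \<tau>2 by fact
  let ?P = "full_orbit \<sigma> x" and ?P' = "full_orbit \<sigma> (\<tau>1 x)"
  let ?Z = "independent_cycles (Supp \<tau>1 \<union> Supp \<tau>2) \<sigma>"
  have Q: "Q = ?P \<union> ?P'"
    by (simp add: Q_def dihedral_orbit_def)
  have Z: "(?P, perm_restrict \<sigma> ?P) \<in> ?Z" "(?P', perm_restrict \<sigma> ?P') \<in> ?Z"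
    using x \<tau>1_in_Supp_union[OF x] unfolding independent_cycles_def by blast+
  consider "?P = ?P'" | "?P \<inter> ?P' = {}"
    using full_orbits_eq_or_disjoint[OF inj_\<sigma>] by blast
  then show ?thesis
  proof cases
    case 1
    with Z Q show ?thesis by (simp add: belonging_perms_def Let_def)
  next
    case 2
    have "perm_restrict \<sigma> ?P' \<circ> perm_restrict \<sigma> ?P = perm_restrict \<sigma> Q"
    proof
      fix y
      have "\<sigma> y \<in> ?P \<longleftrightarrow> y \<in> ?P"
        by (rule image_in_full_orbit_iff[OF inj_\<sigma>])
      with 2 show "(perm_restrict \<sigma> ?P' \<circ> perm_restrict \<sigma> ?P) y = perm_restrict \<sigma> Q y"
        unfolding Q perm_restrict_def by auto
    qed
    then have "(Q, perm_restrict \<sigma> Q) = (?P \<union> ?P', perm_restrict \<sigma> ?P' \<circ> perm_restrict \<sigma> ?P)"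
      using Q by simp
    with Z 2 show ?thesis
      unfolding belonging_perms_def Let_def by blast
  qed
qed

section \<open>Components of the graph\<close>

lemma vertex_in_V1_or_V2: "v \<in> V1 \<or> v \<in> V2"
  by (cases v) (auto simp: V1_def V2_def)

text \<open>
  The graph of two arbitrary involutions: each side of the vertex set enumerates, without
  repetition, the points moved by the corresponding involution.
\<close>

locale involution_graph = involution_pair \<tau>1 \<tau>2 for \<tau>1 \<tau>2 :: "int \<Rightarrow> int" +
  fixes \<mu> :: "vertex \<Rightarrow> int"
  assumes bij1: "bij_betw \<mu> V1 (Supp \<tau>1)"
    and bij2: "bij_betw \<mu> V2 (Supp \<tau>2)"
begin

definition adj :: "(vertex \<times> vertex) set" where
  "adj = {(u, v). {u, v} \<in> Gamma_edges \<mu> \<tau>1 \<tau>2}"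

lemma components_eq_quotient: "connected_components (Gamma_edges \<mu> \<tau>1 \<tau>2) = UNIV // adj\<^sup>*"
  by (simp add: connected_components_def adj_def)

lemma equiv_reachable: "equiv UNIV (adj\<^sup>*)"
proof -
  have "sym adj"
    by (auto simp: sym_def adj_def insert_commute)
  then show ?thesis
    by (intro equivI) (auto simp: refl_on_def intro: sym_rtrancl trans_rtrancl)
qed

lemma adj_value_cases:
  assumes "(u, v) \<in> adj"
  shows "\<mu> v = \<mu> u \<or> \<mu> v = \<tau>1 (\<mu> u) \<or> \<mu> v = \<tau>2 (\<mu> u)"
proof -
  from assms obtain u' v' where uv: "{u, v} = {u', v'}"
    and "\<mu> u' = \<mu> v' \<or> \<tau>1 (\<mu> u') = \<mu> v' \<or> \<tau>2 (\<mu> u') = \<mu> v'"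
    unfolding adj_def Gamma_edges_def by blast
  \<comment> \<open>An unordered edge may have been listed in the other direction; the involutions undo this.\<close>
  then have "\<mu> u' = \<mu> v' \<or> \<mu> v' = \<tau>1 (\<mu> u') \<or> \<mu> v' = \<tau>2 (\<mu> u')"
    and "\<mu> u' = \<mu> v' \<or> \<mu> u' = \<tau>1 (\<mu> v') \<or> \<mu> u' = \<tau>2 (\<mu> v')"
    by (metis \<tau>1_\<tau>1 \<tau>2_\<tau>2)+
  with uv show ?thesis
    by (auto simp: doubleton_eq_iff)
qed

text \<open>
  On the same side injectivity makes equal-valued vertices identical; across the sides they are
  joined by an edge.
\<close>

lemma reachable_if_same_value:
  assumes "\<mu> u = \<mu> v"
  shows "(u, v) \<in> adj\<^sup>*"
proof (cases "u \<in> V1 \<longleftrightarrow> v \<in> V1")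
  case True
  then have "u \<in> V1 \<and> v \<in> V1 \<or> u \<in> V2 \<and> v \<in> V2"
    using vertex_in_V1_or_V2 by blast
  then have "u = v"
    using assms bij_betw_imp_inj_on[OF bij1] bij_betw_imp_inj_on[OF bij2]
    by (auto dest: inj_onD)
  then show ?thesis by simp
next
  case False
  then have "u \<in> V1 \<and> v \<in> V2 \<or> u \<in> V2 \<and> v \<in> V1"
    using vertex_in_V1_or_V2 by blast
  with assms have "(u, v) \<in> adj"
    unfolding adj_def Gamma_edges_def by blast
  then show ?thesis by blast
qed

text \<open>
  Moving along an application of \<open>\<tau>1\<close> may require changing to the side of \<open>\<tau>1\<close> first, through
  another vertex with the same value.
\<close>

lemma reach_\<tau>1_value: "\<exists>w. (v, w) \<in> adj\<^sup>* \<and> \<mu> w = \<tau>1 (\<mu> v)"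
proof (cases "\<tau>1 (\<mu> v) = \<mu> v")
  case True
  then show ?thesis by auto
next
  case False
  then have "\<mu> v \<in> \<mu> ` V1" "\<tau>1 (\<mu> v) \<in> \<mu> ` V1"
    using bij_betw_imp_surj_on[OF bij1] by (auto simp: Supp_def)
  then obtain v' w where "v' \<in> V1" "w \<in> V1" "\<mu> v = \<mu> v'" and w: "\<mu> w = \<tau>1 (\<mu> v)"
    by (metis imageE)
  moreover from this have "\<tau>1 (\<mu> v') = \<mu> w"
    by simp
  ultimately have "(v', w) \<in> adj"
    unfolding adj_def Gamma_edges_def by blast
  with reachable_if_same_value[OF \<open>\<mu> v = \<mu> v'\<close>] w show ?thesis
    by (meson rtrancl.rtrancl_into_rtrancl)
qed

lemma reach_\<tau>2_value: "\<exists>w. (v, w) \<in> adj\<^sup>* \<and> \<mu> w = \<tau>2 (\<mu> v)"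
proof (cases "\<tau>2 (\<mu> v) = \<mu> v")
  case True
  then show ?thesis by auto
next
  case False
  then have "\<mu> v \<in> \<mu> ` V2" "\<tau>2 (\<mu> v) \<in> \<mu> ` V2"
    using bij_betw_imp_surj_on[OF bij2] by (auto simp: Supp_def)
  then obtain v' w where "v' \<in> V2" "w \<in> V2" "\<mu> v = \<mu> v'" and w: "\<mu> w = \<tau>2 (\<mu> v)"
    by (metis imageE)
  moreover from this have "\<tau>2 (\<mu> v') = \<mu> w"
    by simp
  ultimately have "(v', w) \<in> adj"
    unfolding adj_def Gamma_edges_def by blast
  with reachable_if_same_value[OF \<open>\<mu> v = \<mu> v'\<close>] w show ?thesis
    by (meson rtrancl.rtrancl_into_rtrancl)
qed

lemma image_component: "\<mu> ` (adj\<^sup>* `` {u}) = dihedral_orbit (\<mu> u)"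
proof
  show "\<mu> ` (adj\<^sup>* `` {u}) \<subseteq> dihedral_orbit (\<mu> u)"
  proof clarify
    fix v assume "(u, v) \<in> adj\<^sup>*"
    then show "\<mu> v \<in> dihedral_orbit (\<mu> u)"
    proof induction
      case base
      show ?case by (rule dihedral_orbit_refl)
    next
      case (step v w)
      then show ?case
        using adj_value_cases[of v w] \<tau>1_in_dihedral_orbit \<tau>2_in_dihedral_orbit by metis
    qed
  qed
  show "dihedral_orbit (\<mu> u) \<subseteq> \<mu> ` (adj\<^sup>* `` {u})"
  proof (rule dihedral_orbit_subset)
    show "\<mu> u \<in> \<mu> ` (adj\<^sup>* `` {u})" by blast
  next
    fix y assume "y \<in> \<mu> ` (adj\<^sup>* `` {u})"
    then obtain v where v: "(u, v) \<in> adj\<^sup>*" "y = \<mu> v" by blast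
    obtain w where "(v, w) \<in> adj\<^sup>*" "\<mu> w = \<tau>1 y"
      using reach_\<tau>1_value v(2) by blast
    with v(1) show "\<tau>1 y \<in> \<mu> ` (adj\<^sup>* `` {u})"
      by (metis Image_singleton_iff imageI rtrancl_trans)
    obtain w where "(v, w) \<in> adj\<^sup>*" "\<mu> w = \<tau>2 y"
      using reach_\<tau>2_value v(2) by blast
    with v(1) show "\<tau>2 y \<in> \<mu> ` (adj\<^sup>* `` {u})"
      by (metis Image_singleton_iff imageI rtrancl_trans)
  qed
qed

lemma components_eq_if_images_meet:
  assumes "S \<in> UNIV // adj\<^sup>*" "T \<in> UNIV // adj\<^sup>*" "\<mu> ` S \<inter> \<mu> ` T \<noteq> {}"
  shows "S = T"
proof -
  from assms(3) obtain u v where "u \<in> S" "v \<in> T" "\<mu> u = \<mu> v" by auto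
  then show ?thesis
    using quotient_eqI[OF equiv_reachable assms(1,2)] reachable_if_same_value by blast
qed

lemma range_\<mu>: "range \<mu> = Supp \<tau>1 \<union> Supp \<tau>2"
proof -
  have "UNIV = V1 \<union> V2"
    using vertex_in_V1_or_V2 by blast
  then show ?thesis
    using bij_betw_imp_surj_on[OF bij1] bij_betw_imp_surj_on[OF bij2] by (metis image_Un)
qed

definition component_perm :: "vertex set \<Rightarrow> int set \<times> (int \<Rightarrow> int)" where
  "component_perm S = (\<mu> ` S, perm_restrict \<sigma> (\<mu> ` S))"

lemma component_perm_belongs:
  assumes "S \<in> UNIV // adj\<^sup>*"
  shows "component_perm S \<in> belonging_perms \<tau>1 \<tau>2"
proof -
  obtain u where "\<mu> ` S = dihedral_orbit (\<mu> u)"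
    using assms image_component by (metis quotientE)
  moreover have "\<mu> u \<in> Supp \<tau>1 \<union> Supp \<tau>2"
    using range_\<mu> by blast
  ultimately show ?thesis
    using restriction_to_dihedral_orbit_belongs[OF involution_pair_axioms]
    by (simp add: component_perm_def)
qed

lemma inj_on_component_perm: "inj_on component_perm (UNIV // adj\<^sup>*)"
proof (rule inj_onI)
  fix S T assume S: "S \<in> UNIV // adj\<^sup>*" and T: "T \<in> UNIV // adj\<^sup>*"
    and eq: "component_perm S = component_perm T"
  have "S \<noteq> {}"
    using S in_quotient_imp_non_empty[OF equiv_reachable] by blast
  with eq have "\<mu> ` S \<inter> \<mu> ` T \<noteq> {}"
    by (auto simp: component_perm_def)
  with S T show "S = T" by (rule components_eq_if_images_meet)
qed

lemma Supp_component_perm: "Supp (snd (component_perm S)) = \<mu> ` S \<inter> Supp \<sigma>"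
  by (auto simp: component_perm_def Supp_def perm_restrict_def)

lemma Supp_component_perm_disjoint:
  assumes "S \<in> UNIV // adj\<^sup>*" "T \<in> UNIV // adj\<^sup>*" "S \<noteq> T"
  shows "Supp (snd (component_perm S)) \<inter> Supp (snd (component_perm T)) = {}"
  using components_eq_if_images_meet[OF assms(1,2)] assms(3)
  unfolding Supp_component_perm by blast

lemma disjoint_prod_component_perm:
  "disjoint_prod (UNIV // adj\<^sup>*) (\<lambda>S. snd (component_perm S)) = \<sigma>"
proof
  fix x
  let ?C = "UNIV // adj\<^sup>*"
  show "disjoint_prod ?C (\<lambda>S. snd (component_perm S)) x = \<sigma> x"
  proof (cases "\<exists>S\<in>?C. x \<in> Supp (snd (component_perm S))")
    case True
    then obtain S where S: "S \<in> ?C" "x \<in> Supp (snd (component_perm S))" by blast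
    then have "(THE S. S \<in> ?C \<and> x \<in> Supp (snd (component_perm S))) = S"
      using Supp_component_perm_disjoint by (intro the_equality) blast+
    then have "disjoint_prod ?C (\<lambda>S. snd (component_perm S)) x = snd (component_perm S) x"
      using True by (simp add: disjoint_prod_def)
    also have "\<dots> = \<sigma> x"
      using S(2) by (simp add: Supp_component_perm) (simp add: component_perm_def perm_restrict_def)
    finally show ?thesis .
  next
    case False
    have "x \<notin> Supp \<sigma>"
    proof
      assume x: "x \<in> Supp \<sigma>"
      then have "x \<in> range \<mu>"
        unfolding range_\<mu> by (auto simp: Supp_def)
      then obtain u where "x = \<mu> u" by blast
      then have "x \<in> Supp (snd (component_perm (adj\<^sup>* `` {u})))"
        using x by (auto simp: Supp_component_perm)
      moreover have "adj\<^sup>* `` {u} \<in> ?C"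
        by (simp add: quotientI)
      ultimately show False
        using False by blast
    qed
    moreover have "disjoint_prod ?C (\<lambda>S. snd (component_perm S)) x = x"
      using False by (simp add: disjoint_prod_def)
    ultimately show ?thesis
      by (simp add: Supp_def)
  qed
qed

lemma fixed_if_component_perm_id:
  assumes "snd (component_perm S) = id" "v \<in> S"
  shows "\<sigma> (\<mu> v) = \<mu> v"
proof -
  have "perm_restrict \<sigma> (\<mu> ` S) (\<mu> v) = \<mu> v"
    using assms(1) by (simp add: component_perm_def)
  with assms(2) show ?thesis
    by (simp add: perm_restrict_def)
qed

end

section \<open>Class transpositions\<close>

lemma class_transposition_involution:
  assumes "0 < m1" "0 < m2" "residue_class r1 m1 \<inter> residue_class r2 m2 = {}"
  shows "class_transposition r1 m1 r2 m2 (class_transposition r1 m1 r2 m2 n) = n"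
proof -
  consider k where "n = r1 + k * m1" | k where "n = r2 + k * m2"
    | "n \<notin> residue_class r1 m1 \<union> residue_class r2 m2"
    unfolding residue_class_def by blast
  then show ?thesis
    by cases (simp_all add: class_transposition_swap[OF assms])
qed

lemma Supp_class_transposition:
  assumes "0 < m1" "0 < m2" "residue_class r1 m1 \<inter> residue_class r2 m2 = {}"
  shows "Supp (class_transposition r1 m1 r2 m2) = residue_class r1 m1 \<union> residue_class r2 m2"
proof -
  have "r1 + k * m1 \<noteq> r2 + k * m2" for k
    using assms(3) unfolding residue_class_def by blast
  then have "residue_class r1 m1 \<union> residue_class r2 m2 \<subseteq> Supp (class_transposition r1 m1 r2 m2)"
    unfolding Supp_def residue_class_def
    by (auto simp: class_transposition_swap(1,2)[OF assms])
      (metis class_transposition_swap(1,2)[OF assms])+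
  then show ?thesis
    using class_transposition_swap(3)[OF assms] by (auto simp: Supp_def)
qed

text \<open>
  The two symbols of one side parametrise the two residue classes of one transposition; disjointness
  of the classes keeps the parametrisation injective. This serves for either side, with \<open>f\<close> and \<open>g\<close>
  in the place of its two constructors.
\<close>

lemma bij_betw_residue_classes:
  fixes f g :: "int \<Rightarrow> 'v"
  assumes "0 < m" "0 < m'" "residue_class r m \<inter> residue_class r' m' = {}"
    and f: "\<And>k. \<mu> (f k) = r + m * k" and g: "\<And>k. \<mu> (g k) = r' + m' * k"
  shows "bij_betw \<mu> (range f \<union> range g) (residue_class r m \<union> residue_class r' m')"
proof (rule bij_betw_combine[OF _ _ assms(3)])
  have "bij_betw \<mu> (range h) (residue_class s n)"
    if "0 < n" "\<And>k. \<mu> (h k) = s + n * k" for h :: "int \<Rightarrow> 'v" and s n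
    using that by (auto simp: bij_betw_def inj_on_def residue_class_def image_def mult.commute)
  from this[OF assms(1) f] this[OF assms(2) g]
  show "bij_betw \<mu> (range f) (residue_class r m)" "bij_betw \<mu> (range g) (residue_class r' m')"
    by auto
qed

theorem theorem4p2:
  fixes r1 m1 r2 m2 r3 m3 r4 m4 :: int
    and \<tau>1 \<tau>2 :: "int \<Rightarrow> int" and \<mu> :: "vertex \<Rightarrow> int" and \<S> :: "vertex set set"
  assumes "0 \<le> r1" "r1 < m1" "0 \<le> r2" "r2 < m2"
    and "0 \<le> r3" "r3 < m3" "0 \<le> r4" "r4 < m4"
    and "residue_class r1 m1 \<inter> residue_class r2 m2 = {}"
    and "residue_class r3 m3 \<inter> residue_class r4 m4 = {}"
    and "\<tau>1 = class_transposition r1 m1 r2 m2"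
    and "\<tau>2 = class_transposition r3 m3 r4 m4"
    and "\<mu> = vertex_value r1 m1 r2 m2 r3 m3 r4 m4"
    and "\<S> = connected_components (Gamma_edges \<mu> \<tau>1 \<tau>2)"
  shows "\<exists>\<psi> :: vertex set \<Rightarrow> int set \<times> (int \<Rightarrow> int).
           \<psi> ` \<S> \<subseteq> belonging_perms \<tau>1 \<tau>2 \<and>
           inj_on \<psi> \<S> \<and>
           (\<forall>S\<in>\<S>. \<forall>T\<in>\<S>. S \<noteq> T \<longrightarrow> Supp (snd (\<psi> S)) \<inter> Supp (snd (\<psi> T)) = {}) \<and>
           disjoint_prod \<S> (\<lambda>S. snd (\<psi> S)) = \<tau>2 \<circ> \<tau>1 \<and>
           (\<forall>S\<in>\<S>. snd (\<psi> S) = id \<longrightarrow> (\<forall>v\<in>S. (\<tau>2 \<circ> \<tau>1) (\<mu> v) = \<mu> v))"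
proof -
  have pos: "0 < m1" "0 < m2" "0 < m3" "0 < m4"
    using assms(1-8) by auto
  interpret involution_graph \<tau>1 \<tau>2 \<mu>
  proof
    show "\<tau>1 (\<tau>1 x) = x" "\<tau>2 (\<tau>2 x) = x" for x
      using class_transposition_involution pos assms(9-12) by auto
    show "bij_betw \<mu> V1 (Supp \<tau>1)"
      unfolding assms(11,13) V1_def Supp_class_transposition[OF pos(1,2) assms(9)]
      by (rule bij_betw_residue_classes[OF pos(1,2) assms(9)]) simp_all
    show "bij_betw \<mu> V2 (Supp \<tau>2)"
      unfolding assms(12,13) V2_def Supp_class_transposition[OF pos(3,4) assms(10)]
      by (rule bij_betw_residue_classes[OF pos(3,4) assms(10)]) simp_all
  qed
  have "\<S> = UNIV // adj\<^sup>*"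
    using assms(14) components_eq_quotient by simp
  then show ?thesis
    using component_perm_belongs inj_on_component_perm Supp_component_perm_disjoint
      disjoint_prod_component_perm fixed_if_component_perm_id
    by (intro exI[of _ component_perm]) auto
qed

end
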